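(* Let $k\ge 1$ be any integer. BFECC interpolation (based on $k$-linear interpolation) from a uniform rectangular grid in $\mathbb{R}^k$ with equal mesh sizes $\Delta x_1=\Delta x_2=\cdots=\Delta x_k=\Delta x$ to the grid obtained by shifting it along any vector is 3rd order accurate. That is: for every sufficiently smooth function $f:\mathbb{R}^k\to\mathbb{R}$ there is a constant $C$ (depending only on $f$ and $k$) such that for every $0<\Delta x\le 1$ and every vector $\mathbf{w}\in\mathbb{R}^k$, with source grid $\mathcal{G}_1=\{(n_1\Delta x,\dots,n_k\Delta x): n_1,\dots,n_k\in\mathbb{Z}\}$ and target grid $\mathcal{G}_2=\mathcal{G}_1+\mathbf{w}$, the values $f^{new}_{\mathbf{p}}$ produced by BFECC interpolation of $f$ from $\mathcal{G}_1$ to $\mathcal{G}_2$ satisfy $$|f^{new}_{\mathbf{p}}-f(\mathbf{p})|\le C\,\Delta x^3\qquad\text{for every grid point }\mathbf{p}\in\mathcal{G}_2 .$$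
   Context: Local linear interpolation on a rectangular grid: given values at the grid points of an (infinite) uniform rectangular grid in $\mathbb{R}^k$, the value at a point $\mathbf{p}$ is that of the $k$-linear interpolant (linear in 1D, bilinear in 2D, trilinear in 3D, etc.) of the values at the $2^k$ vertices of a closed grid cell containing $\mathbf{p}$; it does not depend on the choice of cell when $\mathbf{p}$ lies in several. BFECC interpolation of a function $f$ from a grid $\mathcal{G}_1$ to a grid $\mathcal{G}_2$ (both infinite uniform rectangular grids, $\mathcal{G}_2$ a translate of $\mathcal{G}_1$): write $f_{\mathbf{i}}$ for the value of $f$ at the grid point $\mathbf{i}\in\mathcal{G}_1$. 1. Forward interpolation: use local linear interpolation to interpolate the values $\{f_{\mathbf{i}}\}$ from the grid points of $\mathcal{G}_1$ to every grid point of $\mathcal{G}_2$, obtaining values $f^*$ on $\mathcal{G}_2$. 2. Backward interpolation: use local linear interpolation to interpolate the values $f^*$ from the grid points of $\mathcal{G}_2$ to every grid point $\mathbf{i}$ of $\mathcal{G}_1$, obtaining $\tilde f_{\mathbf{i}}$. 3. Error compensation: set $\hat f_{\mathbf{i}}=f_{\mathbf{i}}+\frac12(f_{\mathbf{i}}-\tilde f_{\mathbf{i}})$ for every $\mathbf{i}\in\mathcal{G}_1$. 4. Forward interpolation: use local linear interpolation to interpolate the values $\{\hat f_{\mathbf{i}}\}$ from the grid points of $\mathcal{G}_1$ to every grid point $\mathbf{p}$ of $\mathcal{G}_2$; the result is $f^{new}_{\mathbf{p}}$. "Sufficiently smooth" may be read as: $C^\infty$ with all partial derivatives bounded on $\mathbb{R}^k$.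 *)

theory Defs
  imports "HOL-Analysis.Analysis"
begin

definition partial_deriv :: "'n::finite \<Rightarrow> (real ^ 'n \<Rightarrow> real) \<Rightarrow> real ^ 'n \<Rightarrow> real" where
  "partial_deriv i f x = deriv (\<lambda>t. f (x + t *\<^sub>R axis i 1)) 0"

abbreviation iterated_partial :: "'n::finite list \<Rightarrow> (real ^ 'n \<Rightarrow> real) \<Rightarrow> real ^ 'n \<Rightarrow> real" where
  "iterated_partial js \<equiv> foldr partial_deriv js"

text \<open>
  All partial derivatives of all orders exist and are continuous, and those of order at least
  one are bounded. Boundedness of the function itself is not required.
\<close>

definition smooth_bounded_derivs :: "(real ^ 'n::finite \<Rightarrow> real) \<Rightarrow> bool" where
  "smooth_bounded_derivs f \<longleftrightarrow>
     (\<forall>js. continuous_on UNIV (iterated_partial js f) \<and>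
           (\<forall>i x. (\<lambda>t. iterated_partial js f (x + t *\<^sub>R axis i 1)) field_differentiable at 0) \<and>
           (js \<noteq> [] \<longrightarrow> bounded (range (iterated_partial js f))))"

text \<open>
  The grid through \<open>a\<close> with mesh size \<open>d $ i\<close> in direction \<open>i\<close>. Values on a grid are represented by
  functions on the whole space, of which only the values at the grid points are ever used
  (see \<open>grid_interp_cong\<close>).
\<close>

definition grid :: "real ^ 'n::finite \<Rightarrow> real ^ 'n \<Rightarrow> (real ^ 'n) set" where
  "grid a d = {(\<chi> i. a $ i + of_int (n i) * d $ i) | n :: 'n \<Rightarrow> int. True}"

text \<open>
  The vertices of the cell with lower corner \<open>c\<close> are indexed by the set \<open>S\<close> of directions in which
  they lie on the upper side.
\<close>

definition cell_vertex :: "real ^ 'n::finite \<Rightarrow> real ^ 'n \<Rightarrow> 'n set \<Rightarrow> real ^ 'n" where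
  "cell_vertex c d S = (\<chi> i. if i \<in> S then c $ i + d $ i else c $ i)"

definition cell_interp :: "real ^ 'n::finite \<Rightarrow> real ^ 'n \<Rightarrow> (real ^ 'n \<Rightarrow> real) \<Rightarrow> real ^ 'n \<Rightarrow> real" where
  "cell_interp c d g p =
     (\<Sum>S\<in>UNIV. (\<Prod>i\<in>UNIV. if i \<in> S then (p $ i - c $ i) / d $ i else 1 - (p $ i - c $ i) / d $ i)
                 * g (cell_vertex c d S))"

definition cell_corner :: "real ^ 'n::finite \<Rightarrow> real ^ 'n \<Rightarrow> real ^ 'n \<Rightarrow> real ^ 'n" where
  "cell_corner a d p = (\<chi> i. a $ i + of_int \<lfloor>(p $ i - a $ i) / d $ i\<rfloor> * d $ i)"

text \<open>
  The definition picks one cell containing \<open>p\<close>; by \<open>cell_interp_eq_grid_interp\<close> below every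
  closed cell containing \<open>p\<close> gives the same value.
\<close>

definition grid_interp :: "real ^ 'n::finite \<Rightarrow> real ^ 'n \<Rightarrow> (real ^ 'n \<Rightarrow> real) \<Rightarrow> real ^ 'n \<Rightarrow> real" where
  "grid_interp a d g p = cell_interp (cell_corner a d p) d g p"

text \<open>BFECC interpolation from \<open>grid a d\<close> to \<open>grid b d\<close>.\<close>

definition bfecc :: "real ^ 'n::finite \<Rightarrow> real ^ 'n \<Rightarrow> real ^ 'n \<Rightarrow> (real ^ 'n \<Rightarrow> real) \<Rightarrow> real ^ 'n \<Rightarrow> real" where
  "bfecc a b d f =
     (let f_star = grid_interp a d f;
          f_tilde = grid_interp b d f_star;
          f_hat = (\<lambda>x. f x + 1/2 * (f x - f_tilde x))
      in grid_interp a d f_hat)"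

lemma cell_interp_vertex:
  assumes "\<And>i. d $ i > 0"
  shows "cell_interp c d g (cell_vertex c d T) = g (cell_vertex c d T)"
proof -
  have w: "(\<Prod>i\<in>UNIV. if i \<in> S then (cell_vertex c d T $ i - c $ i) / d $ i
             else 1 - (cell_vertex c d T $ i - c $ i) / d $ i) = (if S = T then 1 else 0)" for S
  proof (cases "S = T")
    case True
    have "d $ i \<noteq> 0" for i using assms[of i] by simp
    then show ?thesis using True by (auto simp: cell_vertex_def intro!: prod.neutral)
  next
    case False
    then obtain i where "(i \<in> S) \<noteq> (i \<in> T)" by blast
    then have "\<exists>i. (if i \<in> S then (cell_vertex c d T $ i - c $ i) / d $ i
             else 1 - (cell_vertex c d T $ i - c $ i) / d $ i) = 0"
      using assms[of i] by (intro exI[of _ i]) (auto simp: cell_vertex_def)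
    then show ?thesis using False by (auto intro!: prod_zero)
  qed
  show ?thesis unfolding cell_interp_def w by (simp add: if_distrib[of "\<lambda>x. x * _"] cong: if_cong)
qed

lemma cell_interp_affine_in_each_variable:
  "\<exists>\<alpha> \<beta>. \<forall>t. cell_interp c d g (\<chi> j. if j = i then t else p $ j) = \<alpha> + \<beta> * t"
proof -
  define W where "W S = (\<Prod>j\<in>UNIV-{i}. if j \<in> S then (p $ j - c $ j) / d $ j
                       else 1 - (p $ j - c $ j) / d $ j) * g (cell_vertex c d S)" for S
  define A where "A S = (if i \<in> S then - (c $ i / d $ i) else 1 + c $ i / d $ i)" for S
  define B where "B S = (if i \<in> S then 1 / d $ i else - (1 / d $ i))" for S
  have "cell_interp c d g (\<chi> j. if j = i then t else p $ j)
        = (\<Sum>S\<in>UNIV. (A S + B S * t) * W S)" for t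
    unfolding cell_interp_def
  proof (rule sum.cong[OF refl], goal_cases)
    case (1 S)
    have "(\<Prod>j\<in>UNIV-{i}. if j \<in> S then ((\<chi> j. if j = i then t else p $ j) $ j - c $ j) / d $ j
             else 1 - ((\<chi> j. if j = i then t else p $ j) $ j - c $ j) / d $ j)
        = (\<Prod>j\<in>UNIV-{i}. if j \<in> S then (p $ j - c $ j) / d $ j else 1 - (p $ j - c $ j) / d $ j)"
      by (rule prod.cong) auto
    then show ?case
      by (subst prod.remove[of UNIV i])
         (auto simp: W_def A_def B_def diff_divide_distrib)
  qed
  then have "\<forall>t. cell_interp c d g (\<chi> j. if j = i then t else p $ j)
        = (\<Sum>S\<in>UNIV. A S * W S) + (\<Sum>S\<in>UNIV. B S * W S) * t"
    by (simp add: algebra_simps sum.distrib sum_distrib_left)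
  then show ?thesis by blast
qed

lemma cell_corner_in_grid: "cell_corner a d p \<in> grid a d"
  unfolding grid_def cell_corner_def
  by (intro CollectI exI[of _ "\<lambda>i. \<lfloor>(p $ i - a $ i) / d $ i\<rfloor>"]) simp

lemma in_cell_corner:
  assumes "\<And>i. d $ i > 0"
  shows "p \<in> cbox (cell_corner a d p) (cell_corner a d p + d)"
proof -
  have l: "of_int \<lfloor>(p $ i - a $ i) / d $ i\<rfloor> * d $ i \<le> p $ i - a $ i"
   and u: "p $ i - a $ i < (of_int \<lfloor>(p $ i - a $ i) / d $ i\<rfloor> + 1) * d $ i" for i
    using floor_divide_lower[OF assms[of i], of "p $ i - a $ i"]
      floor_divide_upper[OF assms[of i], of "p $ i - a $ i"] by simp_all
  show ?thesis
    unfolding mem_box_cart cell_corner_def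
  proof (intro allI conjI)
    fix i
    show "(\<chi> i. a $ i + of_int \<lfloor>(p $ i - a $ i) / d $ i\<rfloor> * d $ i) $ i \<le> p $ i"
      using l[of i] by simp
    show "p $ i \<le> ((\<chi> i. a $ i + of_int \<lfloor>(p $ i - a $ i) / d $ i\<rfloor> * d $ i) + d) $ i"
      using u[of i] by (simp add: distrib_right)
  qed
qed

lemma cell_vertex_in_grid:
  assumes "c \<in> grid a d"
  shows "cell_vertex c d S \<in> grid a d"
proof -
  obtain n :: "_ \<Rightarrow> int" where n: "c = (\<chi> i. a $ i + of_int (n i) * d $ i)"
    using assms unfolding grid_def by blast
  have "cell_vertex c d S = (\<chi> i. a $ i + of_int (n i + (if i \<in> S then 1 else 0)) * d $ i)"
    by (simp add: n cell_vertex_def vec_eq_iff algebra_simps)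
  then show ?thesis unfolding grid_def by (auto intro: exI[of _ "\<lambda>i. n i + (if i \<in> S then 1 else 0)"])
qed

lemma grid_interp_cong:
  assumes "\<And>q. q \<in> grid a d \<Longrightarrow> g q = h q"
  shows "grid_interp a d g = grid_interp a d h"
  by (rule ext) (simp add: grid_interp_def cell_interp_def assms cell_vertex_in_grid cell_corner_in_grid)

lemma cell_interp_eq_grid_interp:
  assumes d: "\<And>i. d $ i > 0" and c: "c \<in> grid a d" and p: "p \<in> cbox c (c + d)"
  shows "cell_interp c d g p = grid_interp a d g p"
proof -
  define c' where "c' = cell_corner a d p"
  define D where "D = {i. p $ i = c $ i + d $ i}"
  obtain n :: "_ \<Rightarrow> int" where n: "c = (\<chi> i. a $ i + of_int (n i) * d $ i)"
    using c unfolding grid_def by blast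
  have c': "c' $ i = (if i \<in> D then c $ i + d $ i else c $ i)" for i
  proof -
    have b: "of_int (n i) \<le> (p $ i - a $ i) / d $ i" "(p $ i - a $ i) / d $ i \<le> of_int (n i) + 1"
      using p d[of i] by (auto simp: mem_box_cart n field_simps)
    have "i \<in> D \<longleftrightarrow> (p $ i - a $ i) / d $ i = of_int (n i) + 1"
      using d[of i] by (auto simp: D_def n field_simps)
    with b have "\<lfloor>(p $ i - a $ i) / d $ i\<rfloor> = (if i \<in> D then n i + 1 else n i)"
      by (auto simp: floor_eq_iff)
    then show ?thesis by (simp add: c'_def cell_corner_def n algebra_simps)
  qed
  define w where "w c S = (\<Prod>i\<in>UNIV. if i \<in> S then (p $ i - c $ i) / d $ i else 1 - (p $ i - c $ i) / d $ i)"
    for c S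
  have z: "w c S = 0" if S: "\<not> D \<subseteq> S" for S
  proof -
    obtain i where "i \<in> D" "i \<notin> S" using S by blast
    then have "(if i \<in> S then (p $ i - c $ i) / d $ i else 1 - (p $ i - c $ i) / d $ i) = 0"
      using d[of i] by (simp add: D_def)
    then show ?thesis unfolding w_def by (intro prod_zero bexI[of _ i]) simp_all
  qed
  have z': "w c' S = 0" if S: "D \<inter> S \<noteq> {}" for S
  proof -
    obtain i where "i \<in> D" "i \<in> S" using S by blast
    then have "(if i \<in> S then (p $ i - c' $ i) / d $ i else 1 - (p $ i - c' $ i) / d $ i) = 0"
      unfolding c' by (simp add: D_def)
    then show ?thesis unfolding w_def by (intro prod_zero bexI[of _ i]) simp_all
  qed
  have "cell_interp c d g p = (\<Sum>S\<in>UNIV. w c S * g (cell_vertex c d S))"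
    by (simp add: cell_interp_def w_def)
  also have "\<dots> = (\<Sum>S\<in>{S. D \<subseteq> S}. w c S * g (cell_vertex c d S))"
    by (rule sum.mono_neutral_right) (auto simp: z)
  also have "\<dots> = (\<Sum>S\<in>{S. D \<inter> S = {}}. w c' S * g (cell_vertex c' d S))"
  proof (rule sum.reindex_bij_witness[of _ "\<lambda>S. S \<union> D" "\<lambda>S. S - D"])
    fix S assume S: "S \<in> {S. D \<subseteq> S}"
    have "w c' (S - D) = w c S" unfolding w_def
    proof (rule prod.cong[OF refl])
      fix i
      show "(if i \<in> S - D then (p $ i - c' $ i) / d $ i else 1 - (p $ i - c' $ i) / d $ i)
            = (if i \<in> S then (p $ i - c $ i) / d $ i else 1 - (p $ i - c $ i) / d $ i)"
      proof (cases "i \<in> D")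
        case True
        then have "p $ i = c $ i + d $ i" "i \<in> S" using S by (auto simp: D_def)
        then show ?thesis using True d[of i] by (simp add: c')
      qed (simp add: c')
    qed
    moreover have "cell_vertex c' d (S - D) = cell_vertex c d S"
      using S by (auto simp: cell_vertex_def vec_eq_iff c')
    ultimately show "w c' (S - D) * g (cell_vertex c' d (S - D)) = w c S * g (cell_vertex c d S)"
      by simp
  qed auto
  also have "\<dots> = (\<Sum>S\<in>UNIV. w c' S * g (cell_vertex c' d S))"
    by (rule sum.mono_neutral_left) (auto simp: z')
  also have "\<dots> = grid_interp a d g p"
    by (simp add: grid_interp_def cell_interp_def w_def c'_def)
  finally show ?thesis .
qed

end

theory Submission
  imports Defs
begin

text \<open>
  All points of the target grid have the same position \<open>\<theta>\<close> relative to the cell of the source grid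
  containing them, with \<open>\<theta> $ i\<close> the fractional part of the shift in direction \<open>i\<close> measured in mesh
  sizes. The interpolation weights of the vertices of a cell therefore do not depend on the point:
  they are the probabilities of a random offset \<open>Z\<close> from the point to a vertex, and forward
  interpolation is \<open>g \<mapsto> E g(p + Z)\<close>. Seen from the source grid, the target grid has relative position
  \<open>1 - \<theta>\<close>, so that backward interpolation is \<open>g \<mapsto> E g(q - Z)\<close> (\<open>bfecc_eq_vertex_mean\<close>).
  Linear functions are interpolated exactly, that is, \<open>Z\<close> has mean zero.

  If \<open>P\<close> is a polynomial of degree at most two, then \<open>E P(u + Z) = P(u) + \<kappa>\<close> with a constant \<open>\<kappa>\<close>
  given by the quadratic part of \<open>P\<close> and the second moments of \<open>Z\<close>. These moments do not change when
  \<open>Z\<close> is replaced by \<open>- Z\<close>, so every interpolation, forward or backward, adds the same \<open>\<kappa>\<close>. With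
  three interpolations in the correction term, BFECC returns
  \<open>3/2 (P + \<kappa>) - 1/2 (P + 3 \<kappa>) = P\<close>: it is exact on quadratic polynomials
  (\<open>bfecc_exact_on_quadratic_poly\<close>).

  Finally \<open>f\<close> is replaced by a second-order Taylor polynomial at the target point (\<open>taylor2\<close>). Only
  values of \<open>f\<close> at distance at most three mesh sizes in each coordinate enter, where the remainder is
  of third order in the mesh size, and means do not enlarge it.
\<close>

section \<open>Second-order Taylor expansion from iterated partial derivatives\<close>

lemma smooth_bounded_derivs_iterated_partial:
  assumes "smooth_bounded_derivs g"
  shows "smooth_bounded_derivs (iterated_partial js g)"
proof -
  have "iterated_partial ks (iterated_partial js g) = iterated_partial (ks @ js) g" for ks
    by simp
  then show ?thesis
    using assms unfolding smooth_bounded_derivs_def by (metis append_is_Nil_conv)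
qed

lemma has_partial_deriv:
  assumes "smooth_bounded_derivs g"
  shows "((\<lambda>t. g (x + t *\<^sub>R axis i 1)) has_real_derivative partial_deriv i g (x + t *\<^sub>R axis i 1)) (at t)"
proof -
  let ?y = "x + t *\<^sub>R axis i 1"
  have "(\<lambda>s. iterated_partial [] g (?y + s *\<^sub>R axis i 1)) field_differentiable at 0"
    using assms unfolding smooth_bounded_derivs_def by blast
  then have "((\<lambda>s. g (?y + s *\<^sub>R axis i 1)) has_real_derivative partial_deriv i g ?y) (at 0)"
    by (simp add: partial_deriv_def DERIV_deriv_iff_field_differentiable)
  then have "((\<lambda>s. g (x + (s + t) *\<^sub>R axis i 1)) has_real_derivative partial_deriv i g ?y) (at 0)"
    by (simp add: scaleR_add_left add_ac)
  then show ?thesis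
    using DERIV_shift[of "\<lambda>s. g (x + s *\<^sub>R axis i 1)" _ 0 t] by simp
qed

text \<open>
  The expansion in one coordinate direction. The step is bounded by an independent number \<open>h\<close>, since
  the steps in the different directions will share one bound.
\<close>

lemma taylor_along_axis:
  assumes g: "smooth_bounded_derivs g"
  shows "\<exists>B\<ge>0. \<forall>x t h. \<bar>t\<bar> \<le> h \<longrightarrow>
    \<bar>g (x + t *\<^sub>R axis i 1) - (\<Sum>m\<le>n. iterated_partial (replicate m i) g x * t ^ m / fact m)\<bar>
      \<le> B * h ^ Suc n"
proof -
  have "bounded (range (iterated_partial (replicate (Suc n) i) g))"
    using g unfolding smooth_bounded_derivs_def by (metis Zero_not_Suc length_replicate list.size(3))
  then obtain B where B: "B > 0" "\<And>x. \<bar>iterated_partial (replicate (Suc n) i) g x\<bar> \<le> B"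
    unfolding bounded_pos by auto
  have "\<bar>g (x + t *\<^sub>R axis i 1) - (\<Sum>m\<le>n. iterated_partial (replicate m i) g x * t ^ m / fact m)\<bar>
      \<le> B * h ^ Suc n" if th: "\<bar>t\<bar> \<le> h" for x t h
  proof -
    let ?F = "\<lambda>m s. iterated_partial (replicate m i) g (x + s *\<^sub>R axis i 1)"
    have "norm (?F 0 t - (\<Sum>m\<le>n. ?F m 0 * (t - 0) ^ m / fact m)) \<le> B * norm (t - 0) ^ Suc n / fact n"
    proof (rule field_Taylor[where S = UNIV])
      fix m s assume "m \<le> n"
      show "(?F m has_field_derivative ?F (Suc m) s) (at s within UNIV)"
        using has_partial_deriv[OF smooth_bounded_derivs_iterated_partial[OF g], of "replicate m i" x i s]
        by simp
    qed (use B(2) in auto)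
    also have "\<dots> \<le> B * \<bar>t\<bar> ^ Suc n / 1"
      using B(1) by (intro frac_le) (auto simp: fact_ge_1)
    also have "\<dots> \<le> B * h ^ Suc n"
      using B(1) th by (simp add: mult_left_mono power_mono del: power_Suc)
    finally show ?thesis by simp
  qed
  then show ?thesis using B(1) by (intro exI[of _ B]) auto
qed

text \<open>
  The next three lemmas give the expansions of order zero, one and two for a displacement that moves
  the coordinates in \<open>J\<close> only. A new coordinate is added to \<open>J\<close> by expanding along its axis at the
  point already reached, and then expanding the derivatives found there about \<open>x\<close> by the lemma of
  the next lower order. Moving along one axis at a time keeps every step within reach of the
  one-dimensional expansion and of partial derivatives.
\<close>

lemma lipschitz_along_axes:
  fixes g :: "real ^ 'n::finite \<Rightarrow> real"
  assumes g: "smooth_bounded_derivs g"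
  shows "\<exists>C\<ge>0. \<forall>x u h. (\<forall>i. \<bar>u $ i\<bar> \<le> h) \<longrightarrow>
    \<bar>g (x + (\<Sum>i\<in>J. u $ i *\<^sub>R axis i 1)) - g x\<bar> \<le> C * h"
  using finite[of J]
proof (induction J rule: finite_induct)
  case empty
  show ?case by (intro exI[of _ 0]) auto
next
  case (insert i J)
  from insert.IH obtain C where C: "C \<ge> 0" "\<And>x u h. \<forall>i. \<bar>u $ i\<bar> \<le> h \<Longrightarrow>
      \<bar>g (x + (\<Sum>i\<in>J. u $ i *\<^sub>R axis i 1)) - g x\<bar> \<le> C * h" by blast
  from taylor_along_axis[OF g, where n = 0 and i = i] obtain B where B: "B \<ge> 0"
    "\<And>x t h. \<bar>t\<bar> \<le> h \<Longrightarrow> \<bar>g (x + t *\<^sub>R axis i 1) - g x\<bar> \<le> B * h" by auto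
  show ?case
  proof (intro exI[of _ "C + B"] conjI allI impI)
    fix x u :: "real ^ 'n" and h assume u: "\<forall>i. \<bar>u $ i\<bar> \<le> h"
    define y where "y = x + (\<Sum>i\<in>J. u $ i *\<^sub>R axis i 1)"
    have e: "x + (\<Sum>i\<in>insert i J. u $ i *\<^sub>R axis i 1) = y + u $ i *\<^sub>R axis i 1"
      using insert.hyps by (simp add: y_def)
    have "\<bar>g (y + u $ i *\<^sub>R axis i 1) - g y\<bar> \<le> B * h" using B(2) u by blast
    moreover have "\<bar>g y - g x\<bar> \<le> C * h" unfolding y_def using C(2) u by blast
    ultimately show "\<bar>g (x + (\<Sum>i\<in>insert i J. u $ i *\<^sub>R axis i 1)) - g x\<bar> \<le> (C + B) * h"
      unfolding e by (simp add: distrib_right)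
  qed (use B C in auto)
qed

lemma taylor1_along_axes:
  fixes g :: "real ^ 'n::finite \<Rightarrow> real"
  assumes g: "smooth_bounded_derivs g"
  shows "\<exists>C\<ge>0. \<forall>x u h. (\<forall>i. \<bar>u $ i\<bar> \<le> h) \<longrightarrow>
    \<bar>g (x + (\<Sum>i\<in>J. u $ i *\<^sub>R axis i 1)) - (g x + (\<Sum>i\<in>J. partial_deriv i g x * u $ i))\<bar> \<le> C * h\<^sup>2"
  using finite[of J]
proof (induction J rule: finite_induct)
  case empty
  show ?case by (intro exI[of _ 0]) auto
next
  case (insert i J)
  from insert.IH obtain C where C: "C \<ge> 0" "\<And>x u h. \<forall>i. \<bar>u $ i\<bar> \<le> h \<Longrightarrow>
      \<bar>g (x + (\<Sum>i\<in>J. u $ i *\<^sub>R axis i 1)) - (g x + (\<Sum>i\<in>J. partial_deriv i g x * u $ i))\<bar> \<le> C * h\<^sup>2"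
    by blast
  from taylor_along_axis[OF g, where n = 1 and i = i] obtain B where B: "B \<ge> 0"
    "\<And>x t h. \<bar>t\<bar> \<le> h \<Longrightarrow> \<bar>g (x + t *\<^sub>R axis i 1) - (g x + partial_deriv i g x * t)\<bar> \<le> B * h\<^sup>2"
    by (auto simp: numeral_2_eq_2)
  have "smooth_bounded_derivs (partial_deriv i g)"
    using smooth_bounded_derivs_iterated_partial[OF g, of "[i]"] by simp
  from lipschitz_along_axes[OF this, of J] obtain D where D: "D \<ge> 0" "\<And>x u h. \<forall>i. \<bar>u $ i\<bar> \<le> h \<Longrightarrow>
      \<bar>partial_deriv i g (x + (\<Sum>i\<in>J. u $ i *\<^sub>R axis i 1)) - partial_deriv i g x\<bar> \<le> D * h" by blast
  show ?case
  proof (intro exI[of _ "C + B + D"] conjI allI impI)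
    fix x u :: "real ^ 'n" and h assume u: "\<forall>i. \<bar>u $ i\<bar> \<le> h"
    define y where "y = x + (\<Sum>i\<in>J. u $ i *\<^sub>R axis i 1)"
    have e: "x + (\<Sum>i\<in>insert i J. u $ i *\<^sub>R axis i 1) = y + u $ i *\<^sub>R axis i 1"
      using insert.hyps by (simp add: y_def)
    have "\<bar>g (y + u $ i *\<^sub>R axis i 1) - (g y + partial_deriv i g y * u $ i)\<bar> \<le> B * h\<^sup>2"
      using B(2) u by blast
    moreover have "\<bar>g y - (g x + (\<Sum>i\<in>J. partial_deriv i g x * u $ i))\<bar> \<le> C * h\<^sup>2"
      unfolding y_def using C(2) u by blast
    moreover have "\<bar>partial_deriv i g y * u $ i - partial_deriv i g x * u $ i\<bar> \<le> D * h\<^sup>2"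
    proof -
      have "\<bar>partial_deriv i g y - partial_deriv i g x\<bar> * \<bar>u $ i\<bar> \<le> (D * h) * h"
        unfolding y_def using u by (intro mult_mono' D(2)) auto
      then show ?thesis by (simp add: abs_mult left_diff_distrib[symmetric] power2_eq_square mult.assoc)
    qed
    ultimately show "\<bar>g (x + (\<Sum>i\<in>insert i J. u $ i *\<^sub>R axis i 1))
        - (g x + (\<Sum>i\<in>insert i J. partial_deriv i g x * u $ i))\<bar> \<le> (C + B + D) * h\<^sup>2"
      unfolding e using insert.hyps by (simp add: distrib_right)
  qed (use B C D in auto)
qed

text \<open>
  The quadratic coefficients are left existential because the induction fixes an order of the
  coordinates and produces a triangular matrix: each mixed term is a single derivative
  \<open>\<partial>\<^sub>j \<partial>\<^sub>i g\<close>, with \<open>i\<close> added after \<open>j\<close>.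
\<close>

lemma taylor2_along_axes:
  fixes g :: "real ^ 'n::finite \<Rightarrow> real"
  assumes g: "smooth_bounded_derivs g"
  shows "\<exists>C\<ge>0. \<exists>b. \<forall>x u h. (\<forall>i. \<bar>u $ i\<bar> \<le> h) \<longrightarrow>
    \<bar>g (x + (\<Sum>i\<in>J. u $ i *\<^sub>R axis i 1))
      - (g x + (\<Sum>i\<in>J. partial_deriv i g x * u $ i) + (\<Sum>i\<in>J. \<Sum>j\<in>J. b x i j * (u $ i * u $ j)))\<bar>
      \<le> C * h ^ 3"
  using finite[of J]
proof (induction J rule: finite_induct)
  case empty
  show ?case by (intro exI[of _ 0]) auto
next
  case (insert i J)
  from insert.IH obtain C b where C: "C \<ge> 0" "\<And>x u h. \<forall>i. \<bar>u $ i\<bar> \<le> h \<Longrightarrow>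
      \<bar>g (x + (\<Sum>i\<in>J. u $ i *\<^sub>R axis i 1))
      - (g x + (\<Sum>i\<in>J. partial_deriv i g x * u $ i) + (\<Sum>i\<in>J. \<Sum>j\<in>J. b x i j * (u $ i * u $ j)))\<bar>
      \<le> C * h ^ 3"
    by blast
  let ?g1 = "partial_deriv i g" and ?g2 = "partial_deriv i (partial_deriv i g)"
  from taylor_along_axis[OF g, where n = 2 and i = i] obtain B where B: "B \<ge> 0"
    "\<And>x t h. \<bar>t\<bar> \<le> h \<Longrightarrow> \<bar>g (x + t *\<^sub>R axis i 1) - (g x + ?g1 x * t + ?g2 x * t\<^sup>2 / 2)\<bar> \<le> B * h ^ 3"
    by (auto simp: numeral_2_eq_2 numeral_3_eq_3)
  have g1: "smooth_bounded_derivs ?g1" and g2: "smooth_bounded_derivs ?g2"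
    using smooth_bounded_derivs_iterated_partial[OF g, of "[i]"]
      smooth_bounded_derivs_iterated_partial[OF g, of "[i, i]"] by simp_all
  from taylor1_along_axes[OF g1, of J] obtain D where D: "D \<ge> 0" "\<And>x u h. \<forall>i. \<bar>u $ i\<bar> \<le> h \<Longrightarrow>
      \<bar>?g1 (x + (\<Sum>i\<in>J. u $ i *\<^sub>R axis i 1)) - (?g1 x + (\<Sum>j\<in>J. partial_deriv j ?g1 x * u $ j))\<bar>
      \<le> D * h\<^sup>2" by blast
  from lipschitz_along_axes[OF g2, of J] obtain E where E: "E \<ge> 0" "\<And>x u h. \<forall>i. \<bar>u $ i\<bar> \<le> h \<Longrightarrow>
      \<bar>?g2 (x + (\<Sum>i\<in>J. u $ i *\<^sub>R axis i 1)) - ?g2 x\<bar> \<le> E * h" by blast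
  define b' where "b' x k j = (if k = i then if j = i then ?g2 x / 2 else partial_deriv j ?g1 x
      else if j = i then 0 else b x k j)" for x k j
  show ?case
  proof (intro exI[of _ "C + B + D + E / 2"] exI[of _ b'] conjI allI impI)
    fix x u :: "real ^ 'n" and h assume u: "\<forall>i. \<bar>u $ i\<bar> \<le> h"
    then have h: "0 \<le> h" by (meson abs_ge_zero order_trans)
    define y where "y = x + (\<Sum>i\<in>J. u $ i *\<^sub>R axis i 1)"
    define t where "t = u $ i"
    have t: "\<bar>t\<bar> \<le> h" using u by (simp add: t_def)
    define P where "P = (\<Sum>j\<in>J. partial_deriv j ?g1 x * u $ j)"
    define Q where "Q = (\<Sum>i\<in>J. \<Sum>j\<in>J. b x i j * (u $ i * u $ j))"
    define L where "L = (\<Sum>i\<in>J. partial_deriv i g x * u $ i)"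
    have e: "x + (\<Sum>i\<in>insert i J. u $ i *\<^sub>R axis i 1) = y + t *\<^sub>R axis i 1"
      using insert.hyps by (simp add: y_def t_def)
    have ne: "j \<noteq> i" if "j \<in> J" for j using that insert.hyps by blast
    have "(\<Sum>k\<in>insert i J. \<Sum>j\<in>insert i J. b' x k j * (u $ k * u $ j))
        = ?g2 x / 2 * (t * t) + (\<Sum>j\<in>J. partial_deriv j ?g1 x * (t * u $ j))
          + (\<Sum>k\<in>J. \<Sum>j\<in>J. b x k j * (u $ k * u $ j))"
      using insert.hyps by (simp add: b'_def t_def ne cong: sum.cong)
    also have "\<dots> = ?g2 x * t\<^sup>2 / 2 + t * P + Q"
      by (simp add: P_def Q_def sum_distrib_left power2_eq_square mult_ac)
    finally have q: "(\<Sum>k\<in>insert i J. \<Sum>j\<in>insert i J. b' x k j * (u $ k * u $ j))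
        = ?g2 x * t\<^sup>2 / 2 + t * P + Q" .
    have l: "(\<Sum>k\<in>insert i J. partial_deriv k g x * u $ k) = ?g1 x * t + L"
      using insert.hyps by (simp add: t_def L_def)
    have "\<bar>g (y + t *\<^sub>R axis i 1) - (g y + ?g1 y * t + ?g2 y * t\<^sup>2 / 2)\<bar> \<le> B * h ^ 3"
      using B(2) t by blast
    moreover have "\<bar>g y - (g x + L + Q)\<bar> \<le> C * h ^ 3"
      unfolding y_def L_def Q_def using C(2) u by blast
    moreover have "\<bar>?g1 y * t - (?g1 x * t + t * P)\<bar> \<le> D * h ^ 3"
    proof -
      have "\<bar>?g1 y - (?g1 x + P)\<bar> * \<bar>t\<bar> \<le> (D * h\<^sup>2) * h"
        unfolding y_def P_def using u t by (intro mult_mono' D(2)) auto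
      also have "\<bar>?g1 y - (?g1 x + P)\<bar> * \<bar>t\<bar> = \<bar>?g1 y * t - (?g1 x * t + t * P)\<bar>"
        by (simp add: abs_mult[symmetric] algebra_simps)
      finally show ?thesis by (simp add: power2_eq_square power3_eq_cube mult.assoc)
    qed
    moreover have "\<bar>?g2 y * t\<^sup>2 / 2 - ?g2 x * t\<^sup>2 / 2\<bar> \<le> E / 2 * h ^ 3"
    proof -
      have "\<bar>t\<^sup>2\<bar> \<le> h\<^sup>2" using t h by (simp add: abs_le_square_iff[symmetric])
      then have "\<bar>?g2 y - ?g2 x\<bar> * \<bar>t\<^sup>2\<bar> \<le> (E * h) * h\<^sup>2"
        unfolding y_def using u by (intro mult_mono' E(2)) auto
      also have "\<bar>?g2 y - ?g2 x\<bar> * \<bar>t\<^sup>2\<bar> = \<bar>?g2 y * t\<^sup>2 - ?g2 x * t\<^sup>2\<bar>"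
        by (simp only: abs_mult[symmetric] left_diff_distrib)
      finally have "\<bar>?g2 y * t\<^sup>2 - ?g2 x * t\<^sup>2\<bar> / 2 \<le> E / 2 * h ^ 3"
        by (simp add: power2_eq_square power3_eq_cube mult.assoc)
      then show ?thesis by (simp add: diff_divide_distrib[symmetric])
    qed
    ultimately show "\<bar>g (x + (\<Sum>i\<in>insert i J. u $ i *\<^sub>R axis i 1))
        - (g x + (\<Sum>i\<in>insert i J. partial_deriv i g x * u $ i)
            + (\<Sum>k\<in>insert i J. \<Sum>j\<in>insert i J. b' x k j * (u $ k * u $ j)))\<bar>
        \<le> (C + B + D + E / 2) * h ^ 3"
      unfolding e q l distrib_right by linarith
  qed (use B C D E in auto)
qed

definition quadratic_poly ::
    "real \<Rightarrow> ('n \<Rightarrow> real) \<Rightarrow> ('n \<Rightarrow> 'n \<Rightarrow> real) \<Rightarrow> real ^ 'n::finite \<Rightarrow> real" where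
  "quadratic_poly c a b u =
     c + (\<Sum>i\<in>UNIV. a i * u $ i) + (\<Sum>i\<in>UNIV. \<Sum>j\<in>UNIV. b i j * (u $ i * u $ j))"

lemma taylor2:
  fixes g :: "real ^ 'n::finite \<Rightarrow> real"
  assumes "smooth_bounded_derivs g"
  shows "\<exists>C\<ge>0. \<exists>a b. \<forall>x u h. (\<forall>i. \<bar>u $ i\<bar> \<le> h) \<longrightarrow>
    \<bar>g (x + u) - quadratic_poly (g x) (a x) (b x) u\<bar> \<le> C * h ^ 3"
proof -
  have "(\<Sum>i\<in>UNIV. u $ i *\<^sub>R axis i 1) = u" for u :: "real ^ 'n"
    using basis_expansion[of u] by (simp add: scalar_mult_eq_scaleR)
  with taylor2_along_axes[OF assms, of UNIV] obtain C b where "C \<ge> 0"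
    "\<forall>x u h. (\<forall>i. \<bar>u $ i\<bar> \<le> h) \<longrightarrow>
      \<bar>g (x + u) - quadratic_poly (g x) (\<lambda>i. partial_deriv i g x) (b x) u\<bar> \<le> C * h ^ 3"
    unfolding quadratic_poly_def by auto
  then show ?thesis
    by (intro exI[of _ C] exI[of _ "\<lambda>x i. partial_deriv i g x"] exI[of _ b] conjI)
qed

section \<open>Multilinear interpolation as a mean over the vertices of a cell\<close>

text \<open>
  For a point at relative position \<open>\<theta>\<close> in its cell, the weights below are the distribution of a
  random set \<open>S\<close> that contains each direction \<open>i\<close> independently with probability \<open>\<theta> $ i\<close>; the offset
  leads from the point to the vertex indexed by \<open>S\<close>.
\<close>

definition vertex_weight :: "real ^ 'n::finite \<Rightarrow> 'n set \<Rightarrow> real" where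
  "vertex_weight \<theta> S = (\<Prod>i\<in>UNIV. if i \<in> S then \<theta> $ i else 1 - \<theta> $ i)"

definition vertex_offset :: "real ^ 'n::finite \<Rightarrow> real ^ 'n \<Rightarrow> 'n set \<Rightarrow> real ^ 'n" where
  "vertex_offset d \<theta> S = (\<chi> i. ((if i \<in> S then 1 else 0) - \<theta> $ i) * d $ i)"

definition vertex_mean :: "real ^ 'n::finite \<Rightarrow> ('n set \<Rightarrow> real) \<Rightarrow> real" where
  "vertex_mean \<theta> g = (\<Sum>S\<in>UNIV. vertex_weight \<theta> S * g S)"

lemma sum_over_subsets_prod:
  fixes f g :: "'n::finite \<Rightarrow> real"
  shows "(\<Sum>S\<in>UNIV. \<Prod>i\<in>UNIV. if i \<in> S then f i else g i) = (\<Prod>i\<in>UNIV. f i + g i)"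
proof -
  have "(\<Prod>i\<in>UNIV. if i \<in> S then f i else g i) = prod f S * prod g (UNIV - S)" for S
    by (simp add: prod.If_cases Compl_eq_Diff_UNIV)
  then show ?thesis by (simp add: prod_add)
qed

lemma vertex_mean_const [simp]: "vertex_mean \<theta> (\<lambda>_. c) = c"
  using sum_over_subsets_prod[of "\<lambda>i. \<theta> $ i" "\<lambda>i. 1 - \<theta> $ i"]
  by (simp add: vertex_mean_def vertex_weight_def sum_distrib_right[symmetric])

text \<open>
  The factor \<open>1 - \<theta> $ i\<close> or \<open>- \<theta> $ i\<close> is absorbed into the \<open>i\<close>-th factor of the weight, so that the
  sum is again a product, whose \<open>i\<close>-th factor is \<open>\<theta> $ i * (1 - \<theta> $ i) - (1 - \<theta> $ i) * \<theta> $ i = 0\<close>.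
\<close>

lemma vertex_mean_offset [simp]: "vertex_mean \<theta> (\<lambda>S. vertex_offset d \<theta> S $ i) = 0"
proof -
  let ?f = "\<lambda>j. \<theta> $ j * (if j = i then 1 - \<theta> $ i else 1)"
  let ?g = "\<lambda>j. (1 - \<theta> $ j) * (if j = i then - \<theta> $ i else 1)"
  have "vertex_weight \<theta> S * ((if i \<in> S then 1 else 0) - \<theta> $ i)
      = (\<Prod>j\<in>UNIV. if j \<in> S then ?f j else ?g j)" for S
  proof -
    have "(\<Prod>j\<in>UNIV. if j \<in> S then ?f j else ?g j)
        = (\<Prod>j\<in>UNIV. (if j \<in> S then \<theta> $ j else 1 - \<theta> $ j)
            * (if j = i then (if i \<in> S then 1 else 0) - \<theta> $ i else 1))"
      by (rule prod.cong) auto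
    then show ?thesis by (simp add: prod.distrib vertex_weight_def)
  qed
  then have "(\<Sum>S\<in>UNIV. vertex_weight \<theta> S * ((if i \<in> S then 1 else 0) - \<theta> $ i))
      = (\<Prod>j\<in>UNIV. ?f j + ?g j)"
    by (simp add: sum_over_subsets_prod)
  also have "\<dots> = 0"
    by (rule prod_zero) (auto intro!: bexI[of _ i] simp: algebra_simps)
  finally have "(\<Sum>S\<in>UNIV. vertex_weight \<theta> S * ((if i \<in> S then 1 else 0) - \<theta> $ i)) = 0" .
  then have "(\<Sum>S\<in>UNIV. vertex_weight \<theta> S * ((if i \<in> S then 1 else 0) - \<theta> $ i)) * d $ i = 0"
    by simp
  then show ?thesis
    by (simp add: vertex_mean_def vertex_offset_def sum_distrib_right mult.assoc)
qed

lemma vertex_mean_add: "vertex_mean \<theta> (\<lambda>S. g S + h S) = vertex_mean \<theta> g + vertex_mean \<theta> h"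
  by (simp add: vertex_mean_def distrib_left sum.distrib)

lemma vertex_mean_cmult: "vertex_mean \<theta> (\<lambda>S. c * g S) = c * vertex_mean \<theta> g"
  by (simp add: vertex_mean_def sum_distrib_left mult_ac)

lemma vertex_mean_diff: "vertex_mean \<theta> (\<lambda>S. g S - h S) = vertex_mean \<theta> g - vertex_mean \<theta> h"
  by (simp add: vertex_mean_def right_diff_distrib sum_subtractf)

lemma vertex_mean_sum: "vertex_mean \<theta> (\<lambda>S. \<Sum>i\<in>I. g i S) = (\<Sum>i\<in>I. vertex_mean \<theta> (g i))"
  unfolding vertex_mean_def sum_distrib_left by (rule sum.swap)

lemma abs_vertex_mean_le:
  assumes \<theta>: "\<And>i. 0 \<le> \<theta> $ i" "\<And>i. \<theta> $ i \<le> 1" and g: "\<And>S. \<bar>g S\<bar> \<le> e"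
  shows "\<bar>vertex_mean \<theta> g\<bar> \<le> e"
proof -
  have w: "0 \<le> vertex_weight \<theta> S" for S
    unfolding vertex_weight_def using \<theta> by (intro prod_nonneg) auto
  have "\<bar>vertex_mean \<theta> g\<bar> \<le> (\<Sum>S\<in>UNIV. \<bar>vertex_weight \<theta> S * g S\<bar>)"
    unfolding vertex_mean_def by (rule sum_abs)
  also have "\<dots> \<le> vertex_mean \<theta> (\<lambda>_. e)"
    unfolding vertex_mean_def using w g by (intro sum_mono) (simp add: abs_mult mult_left_mono)
  finally show ?thesis by simp
qed

text \<open>
  The relative position \<open>\<theta> $ i = 1\<close> is included. It occurs in backward interpolation when the two
  grids agree in direction \<open>i\<close>: the cell used there is then not the one chosen by \<open>cell_corner\<close>, and
  the independence of the cell is what makes one formula cover all shifts.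
\<close>

lemma grid_interp_eq_vertex_mean:
  assumes d: "\<And>i. d $ i > 0" and \<theta>: "\<And>i. 0 \<le> \<theta> $ i" "\<And>i. \<theta> $ i \<le> 1"
    and c: "c \<in> grid a d" and p: "\<And>i. p $ i = c $ i + \<theta> $ i * d $ i"
  shows "grid_interp a d g p = vertex_mean \<theta> (\<lambda>S. g (p + vertex_offset d \<theta> S))"
proof -
  have "\<theta> $ i * d $ i \<le> 1 * d $ i" for i
    using \<theta>(2)[of i] d[of i] by (intro mult_right_mono) auto
  then have "p \<in> cbox c (c + d)"
    using \<theta>(1) d by (auto simp: mem_box_cart p less_imp_le)
  then have "grid_interp a d g p = cell_interp c d g p"
    using cell_interp_eq_grid_interp[OF d c] by simp
  moreover have "(p $ i - c $ i) / d $ i = \<theta> $ i" for i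
    using d[of i] by (simp add: p)
  moreover have "cell_vertex c d S = p + vertex_offset d \<theta> S" for S
    by (simp add: vec_eq_iff cell_vertex_def vertex_offset_def p algebra_simps)
  ultimately show ?thesis
    by (simp add: cell_interp_def vertex_mean_def vertex_weight_def cong: if_cong)
qed

text \<open>
  Exchanging lower and upper vertices turns the mean for the relative position \<open>1 - \<theta>\<close> into the one
  for \<open>\<theta>\<close> with reversed offsets; this describes backward interpolation by the same random offset as
  forward interpolation.
\<close>

lemma vertex_mean_complement:
  fixes \<theta> d :: "real ^ 'n::finite"
  shows
  "vertex_mean (\<chi> i. 1 - \<theta> $ i) (\<lambda>S. g (vertex_offset d (\<chi> i. 1 - \<theta> $ i) S))
   = vertex_mean \<theta> (\<lambda>S. g (- vertex_offset d \<theta> S))"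
proof -
  have "vertex_weight (\<chi> i. 1 - \<theta> $ i) (- S) = vertex_weight \<theta> S" for S
    unfolding vertex_weight_def by (rule prod.cong) auto
  moreover have "vertex_offset d (\<chi> i. 1 - \<theta> $ i) (- S) = - vertex_offset d \<theta> S" for S
    by (simp add: vertex_offset_def vec_eq_iff algebra_simps)
  moreover have "vertex_mean (\<chi> i. 1 - \<theta> $ i) (\<lambda>S. g (vertex_offset d (\<chi> i. 1 - \<theta> $ i) S))
      = (\<Sum>S\<in>UNIV. vertex_weight (\<chi> i. 1 - \<theta> $ i) (- S) * g (vertex_offset d (\<chi> i. 1 - \<theta> $ i) (- S)))"
    unfolding vertex_mean_def by (rule sum.reindex_bij_witness[of _ uminus uminus]) auto
  ultimately show ?thesis
    by (simp add: vertex_mean_def)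
qed

section \<open>BFECC interpolation as a combination of means\<close>

text \<open>
  The point is that one \<open>\<theta>\<close> serves all three interpolations and all points of the target grid. The
  error compensation \<open>f + 1/2 (f - f~)\<close> accounts for the coefficients \<open>3/2\<close> and \<open>- 1/2\<close>.
\<close>

lemma bfecc_eq_vertex_mean:
  fixes a b d :: "real ^ 'n::finite"
  assumes d: "\<And>i. d $ i > 0"
  shows "\<exists>\<theta>. (\<forall>i. 0 \<le> \<theta> $ i \<and> \<theta> $ i \<le> 1) \<and> (\<forall>f. \<forall>p\<in>grid b d. bfecc a b d f p
    = 3 / 2 * vertex_mean \<theta> (\<lambda>S. f (p + vertex_offset d \<theta> S))
      - 1 / 2 * vertex_mean \<theta> (\<lambda>S. vertex_mean \<theta> (\<lambda>T. vertex_mean \<theta> (\<lambda>U.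
          f (p + vertex_offset d \<theta> S - vertex_offset d \<theta> T + vertex_offset d \<theta> U)))))"
proof -
  define r where "r i = (b $ i - a $ i) / d $ i" for i
  define \<theta> :: "real ^ 'n" where "\<theta> = (\<chi> i. frac (r i))"
  define z where "z = vertex_offset d \<theta>"
  have \<theta>: "0 \<le> \<theta> $ i" "\<theta> $ i \<le> 1" for i
    by (simp_all add: \<theta>_def frac_lt_1 less_imp_le)
  have b: "b $ i = a $ i + (of_int \<lfloor>r i\<rfloor> + \<theta> $ i) * d $ i" for i
    using d[of i] by (simp add: \<theta>_def frac_def) (simp add: r_def)
  have fwd: "grid_interp a d g p = vertex_mean \<theta> (\<lambda>S. g (p + z S)) \<and> (\<forall>S. p + z S \<in> grid a d)"
    if p: "p \<in> grid b d" for g p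
  proof -
    obtain n :: "'n \<Rightarrow> int" where n: "p = (\<chi> i. b $ i + of_int (n i) * d $ i)"
      using p unfolding grid_def by blast
    let ?c = "\<chi> i. a $ i + of_int (n i + \<lfloor>r i\<rfloor>) * d $ i"
    have c: "?c \<in> grid a d" unfolding grid_def by (intro CollectI exI conjI TrueI) (rule refl)
    have "p + z S = cell_vertex ?c d S" for S
      by (simp add: vec_eq_iff cell_vertex_def z_def vertex_offset_def n b algebra_simps)
    then have "p + z S \<in> grid a d" for S using cell_vertex_in_grid[OF c] by simp
    moreover have "grid_interp a d g p = vertex_mean \<theta> (\<lambda>S. g (p + z S))"
      unfolding z_def by (rule grid_interp_eq_vertex_mean[OF d \<theta> c]) (simp add: n b algebra_simps)
    ultimately show ?thesis by blast
  qed
  have bwd: "grid_interp b d g q = vertex_mean \<theta> (\<lambda>S. g (q - z S)) \<and> (\<forall>S. q - z S \<in> grid b d)"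
    if q: "q \<in> grid a d" for g q
  proof -
    obtain n :: "'n \<Rightarrow> int" where n: "q = (\<chi> i. a $ i + of_int (n i) * d $ i)"
      using q unfolding grid_def by blast
    \<comment> \<open>The lower corner lies \<open>1 - \<theta> $ i\<close> mesh sizes below \<open>q\<close>.\<close>
    let ?c = "\<chi> i. b $ i + of_int (n i - \<lfloor>r i\<rfloor> - 1) * d $ i"
    have c: "?c \<in> grid b d" unfolding grid_def by (intro CollectI exI conjI TrueI) (rule refl)
    have "q - z S = cell_vertex ?c d (- S)" for S
      by (simp add: vec_eq_iff cell_vertex_def z_def vertex_offset_def n b algebra_simps)
    then have "q - z S \<in> grid b d" for S using cell_vertex_in_grid[OF c] by simp
    moreover have "grid_interp b d g q = vertex_mean (\<chi> i. 1 - \<theta> $ i)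
        (\<lambda>S. g (q + vertex_offset d (\<chi> i. 1 - \<theta> $ i) S))"
      using \<theta> by (intro grid_interp_eq_vertex_mean[OF d _ _ c]) (simp_all add: n b algebra_simps)
    ultimately show ?thesis
      using vertex_mean_complement[of \<theta> "\<lambda>v. g (q + v)" d] by (simp add: z_def)
  qed
  have "bfecc a b d f p = 3 / 2 * vertex_mean \<theta> (\<lambda>S. f (p + z S))
      - 1 / 2 * vertex_mean \<theta> (\<lambda>S. vertex_mean \<theta> (\<lambda>T. vertex_mean \<theta> (\<lambda>U. f (p + z S - z T + z U))))"
    if p: "p \<in> grid b d" for f p
  proof -
    have "grid_interp b d (grid_interp a d f) (p + z S)
        = vertex_mean \<theta> (\<lambda>T. vertex_mean \<theta> (\<lambda>U. f (p + z S - z T + z U)))" for S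
    proof -
      have "p + z S \<in> grid a d" using fwd[OF p] by blast
      from bwd[OF this] show ?thesis by (simp add: fwd)
    qed
    then have "bfecc a b d f p = vertex_mean \<theta> (\<lambda>S. f (p + z S) + 1 / 2 * (f (p + z S)
        - vertex_mean \<theta> (\<lambda>T. vertex_mean \<theta> (\<lambda>U. f (p + z S - z T + z U)))))"
      using fwd[OF p] by (simp add: bfecc_def Let_def)
    then show ?thesis
      by (simp only: vertex_mean_add vertex_mean_cmult vertex_mean_diff) (simp add: field_simps)
  qed
  with \<theta> show ?thesis unfolding z_def by blast
qed

section \<open>Exactness on quadratic polynomials\<close>

text \<open>
  The terms linear in the offset have mean zero, so the mean shifts a quadratic polynomial by a
  constant. With \<open>\<sigma> = 1\<close> this is forward and with \<open>\<sigma> = - 1\<close> backward interpolation; the shift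
  contains \<open>\<sigma>\<close> only through its square.
\<close>

lemma vertex_mean_quadratic_poly:
  assumes \<sigma>: "\<sigma> * \<sigma> = 1"
  shows "vertex_mean \<theta> (\<lambda>S. quadratic_poly c a b (u + \<sigma> *\<^sub>R vertex_offset d \<theta> S))
    = quadratic_poly c a b u
      + (\<Sum>i\<in>UNIV. \<Sum>j\<in>UNIV. b i j * vertex_mean \<theta> (\<lambda>S. vertex_offset d \<theta> S $ i * vertex_offset d \<theta> S $ j))"
proof -
  let ?z = "vertex_offset d \<theta>"
  have "vertex_mean \<theta> (\<lambda>S. a i * (u $ i + \<sigma> * ?z S $ i)) = a i * u $ i" for i
    by (simp add: vertex_mean_add vertex_mean_cmult)
  moreover have "vertex_mean \<theta> (\<lambda>S. b i j * ((u $ i + \<sigma> * ?z S $ i) * (u $ j + \<sigma> * ?z S $ j)))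
      = b i j * (u $ i * u $ j) + b i j * vertex_mean \<theta> (\<lambda>S. ?z S $ i * ?z S $ j)" for i j
  proof -
    have "(u $ i + \<sigma> * ?z S $ i) * (u $ j + \<sigma> * ?z S $ j)
        = u $ i * u $ j + (u $ i * \<sigma>) * ?z S $ j + (u $ j * \<sigma>) * ?z S $ i
          + (\<sigma> * \<sigma>) * (?z S $ i * ?z S $ j)" for S
      by (simp add: algebra_simps)
    then show ?thesis
      by (simp only: vertex_mean_cmult vertex_mean_add \<sigma>) (simp add: algebra_simps)
  qed
  ultimately show ?thesis
    by (simp add: quadratic_poly_def vertex_mean_add vertex_mean_sum sum.distrib)
qed

text \<open>
  The single mean shifts \<open>P\<close> by \<open>\<kappa>\<close> and the triple mean by \<open>3 * \<kappa>\<close>, which cancels under the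
  coefficients \<open>3/2\<close> and \<open>- 1/2\<close>.
\<close>

lemma bfecc_exact_on_quadratic_poly:
  fixes a :: "'n::finite \<Rightarrow> real" and b :: "'n \<Rightarrow> 'n \<Rightarrow> real" and c :: real
    and d \<theta> :: "real ^ 'n"
  defines "P \<equiv> quadratic_poly c a b" and "z \<equiv> vertex_offset d \<theta>"
  shows "3 / 2 * vertex_mean \<theta> (\<lambda>S. P (z S))
      - 1 / 2 * vertex_mean \<theta> (\<lambda>S. vertex_mean \<theta> (\<lambda>T. vertex_mean \<theta> (\<lambda>U. P (z S - z T + z U)))) = c"
proof -
  obtain \<kappa> where fwd: "\<And>u. vertex_mean \<theta> (\<lambda>S. P (u + z S)) = P u + \<kappa>"
    and bwd: "\<And>u. vertex_mean \<theta> (\<lambda>S. P (u - z S)) = P u + \<kappa>"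
    using vertex_mean_quadratic_poly[of 1 \<theta> c a b _ d] vertex_mean_quadratic_poly[of "-1" \<theta> c a b _ d]
    unfolding P_def z_def by simp
  have "P 0 = c" by (simp add: P_def quadratic_poly_def)
  then show ?thesis
    using fwd[of 0] by (simp add: fwd bwd vertex_mean_add) (simp add: field_simps)
qed

section \<open>Third-order accuracy\<close>

text \<open>
  The mesh sizes may differ between the directions, since the cancellation of the quadratic terms
  takes place for each pair of directions separately.
\<close>

theorem bfecc_third_order:
  fixes f :: "real ^ 'n::finite \<Rightarrow> real"
  assumes "smooth_bounded_derivs f"
  shows "\<exists>C. \<forall>a b d h. (\<forall>i. 0 < d $ i \<and> d $ i \<le> h) \<longrightarrow>
           (\<forall>p\<in>grid b d. \<bar>bfecc a b d f p - f p\<bar> \<le> C * h ^ 3)"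
proof -
  from taylor2[OF assms] obtain C \<alpha> \<beta> where C: "C \<ge> 0"
    "\<And>x u h. \<forall>i. \<bar>u $ i\<bar> \<le> h \<Longrightarrow> \<bar>f (x + u) - quadratic_poly (f x) (\<alpha> x) (\<beta> x) u\<bar> \<le> C * h ^ 3"
    by blast
  \<comment> \<open>\<open>15 = 3/2 + 1/2 * 3 ^ 3\<close>, since the triple mean reaches three mesh sizes far\<close>
  have "\<bar>bfecc a b d f p - f p\<bar> \<le> (15 * C) * h ^ 3"
    if d: "\<forall>i. 0 < d $ i \<and> d $ i \<le> h" and p: "p \<in> grid b d" for a b d h p
  proof -
    obtain \<theta> where \<theta>: "\<And>i. 0 \<le> \<theta> $ i" "\<And>i. \<theta> $ i \<le> 1"
      and bf: "bfecc a b d f p = 3 / 2 * vertex_mean \<theta> (\<lambda>S. f (p + vertex_offset d \<theta> S))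
      - 1 / 2 * vertex_mean \<theta> (\<lambda>S. vertex_mean \<theta> (\<lambda>T. vertex_mean \<theta> (\<lambda>U.
          f (p + vertex_offset d \<theta> S - vertex_offset d \<theta> T + vertex_offset d \<theta> U))))"
      using bfecc_eq_vertex_mean[of d b a] d p by metis
    define z where "z = vertex_offset d \<theta>"
    define P where "P = quadratic_poly (f p) (\<alpha> p) (\<beta> p)"
    have z: "\<bar>z S $ i\<bar> \<le> h" for S i
    proof -
      have "\<bar>(if i \<in> S then 1 else 0) - \<theta> $ i\<bar> * \<bar>d $ i\<bar> \<le> 1 * h"
        using d \<theta>[of i] by (intro mult_mono') (auto simp: less_imp_le)
      then show ?thesis by (simp add: z_def vertex_offset_def abs_mult)
    qed
    have z3: "\<bar>(z S - z T + z U) $ i\<bar> \<le> 3 * h" for S T U i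
      using z[of S i] z[of T i] z[of U i] by simp
    have R1: "\<bar>f (p + z S) - P (z S)\<bar> \<le> C * h ^ 3" for S
      unfolding P_def using z by (intro C(2)) blast
    have R3: "\<bar>f (p + z S - z T + z U) - P (z S - z T + z U)\<bar> \<le> C * (3 * h) ^ 3" for S T U
      using C(2)[of "z S - z T + z U" "3 * h" p] z3 by (simp add: P_def add_diff_eq add.assoc[symmetric])
    have "f p = 3 / 2 * vertex_mean \<theta> (\<lambda>S. P (z S))
      - 1 / 2 * vertex_mean \<theta> (\<lambda>S. vertex_mean \<theta> (\<lambda>T. vertex_mean \<theta> (\<lambda>U. P (z S - z T + z U))))"
      unfolding P_def z_def by (rule bfecc_exact_on_quadratic_poly[symmetric])
    then have "bfecc a b d f p - f p = 3 / 2 * vertex_mean \<theta> (\<lambda>S. f (p + z S) - P (z S))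
      - 1 / 2 * vertex_mean \<theta> (\<lambda>S. vertex_mean \<theta> (\<lambda>T. vertex_mean \<theta> (\<lambda>U.
          f (p + z S - z T + z U) - P (z S - z T + z U))))"
      unfolding bf z_def[symmetric] by (simp add: vertex_mean_diff algebra_simps)
    moreover have "\<bar>vertex_mean \<theta> (\<lambda>S. f (p + z S) - P (z S))\<bar> \<le> C * h ^ 3"
      by (intro abs_vertex_mean_le \<theta> R1)
    moreover have "\<bar>vertex_mean \<theta> (\<lambda>S. vertex_mean \<theta> (\<lambda>T. vertex_mean \<theta> (\<lambda>U.
          f (p + z S - z T + z U) - P (z S - z T + z U))))\<bar> \<le> C * (3 * h) ^ 3"
      by (intro abs_vertex_mean_le \<theta> R3)
    ultimately show ?thesis by (simp add: power_mult_distrib)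
  qed
  then show ?thesis by blast
qed

theorem theorem2:
  fixes f :: "real ^ 'n::finite \<Rightarrow> real"
  assumes "smooth_bounded_derivs f"
  shows "\<exists>C. \<forall>\<Delta>x w. 0 < \<Delta>x \<and> \<Delta>x \<le> 1 \<longrightarrow>
           (\<forall>p \<in> (\<lambda>q. q + w) ` grid 0 (\<chi> i. \<Delta>x).
              \<bar>bfecc 0 w (\<chi> i. \<Delta>x) f p - f p\<bar> \<le> C * \<Delta>x ^ 3)"
proof -
  have shift: "q + w \<in> grid w d" if "q \<in> grid 0 d" for q w d :: "real ^ 'n"
    using that unfolding grid_def by (fastforce simp: vec_eq_iff)
  from bfecc_third_order[OF assms] obtain C where
    C: "\<And>a b d h p. \<forall>i. 0 < d $ i \<and> d $ i \<le> h \<Longrightarrow> p \<in> grid b d \<Longrightarrow> \<bar>bfecc a b d f p - f p\<bar> \<le> C * h ^ 3"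
    by blast
  show ?thesis
    by (intro exI[of _ C] allI impI ballI C) (auto intro: shift)
qed

end
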